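(* If $\Phi\subset N_{\mathbb R}$ is admissible and $t>0$, then $\Phi(t)$ is a polygonal domain (of rational slopes).
   Context: $N\cong\mathbb Z^2$ is a rank two lattice, $N_{\mathbb R}=N\otimes\mathbb R$, $M=\operatorname{Hom}(N,\mathbb Z)$. A half-plane with rational slope is $H=\{p\in N_{\mathbb R}:\lambda(p)\ge c\}$ with $c\in\mathbb R$ and $\lambda\in M$ primitive; for $t\in\mathbb R$, $H(t)=\{p:\lambda(p)\ge c+t\}$. For convex $\Phi$, $\mathcal H_\Phi$ is the set of rational-slope half-planes $H$ with $H\supset\Phi$ and $\partial H\cap\partial\Phi\neq\emptyset$. $\Phi$ is admissible if it is closed, convex and $\mathcal H_\Phi\ne\emptyset$; then $\Phi(t)=\bigcap_{H\in\mathcal H_\Phi}H(t)$ for $t\ge0$. A polygonal domain of rational slopes is a convex set $\Psi\subset N_{\mathbb R}$ (possibly degenerate or empty) such that for every bounded region $R\subset N_{\mathbb R}$ there is a finite collection of half-planes with rational slope whose intersection $Q$ satisfies $\Psi\cap R=Q\cap R$. *)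

theory Defs
  imports "HOL-Analysis.Analysis"
begin

text \<open>
  The real vector space \<open>'a\<close> plays the role of \<open>N \<otimes> \<real>\<close>; \<open>N\<close> is given inside it as the set of
  integer combinations of a basis with two elements, which forces \<open>'a\<close> to have dimension two.
\<close>

definition rank_two_lattice :: "'a::euclidean_space set \<Rightarrow> bool" where
  "rank_two_lattice N \<longleftrightarrow>
     (\<exists>B. card B = 2 \<and> independent B \<and> span B = UNIV \<and>
          N = {\<Sum>b\<in>B. of_int (k b) *\<^sub>R b | k :: 'a \<Rightarrow> int. True})"

text \<open>
  A homomorphism \<open>N \<rightarrow> \<int>\<close> is identified with its unique real-linear extension.
\<close>

definition dual_lattice :: "'a::euclidean_space set \<Rightarrow> ('a \<Rightarrow> real) set" where
  "dual_lattice N = {l. linear l \<and> l ` N \<subseteq> \<int>}"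

text \<open>
  Since \<open>0 = 2 * 0\<close>, the zero functional is not primitive.
\<close>

definition primitive :: "'a::euclidean_space set \<Rightarrow> ('a \<Rightarrow> real) \<Rightarrow> bool" where
  "primitive N l \<longleftrightarrow> l \<in> dual_lattice N \<and>
     (\<forall>k::int. \<forall>m\<in>dual_lattice N. l = (\<lambda>p. of_int k * m p) \<longrightarrow> \<bar>k\<bar> = 1)"

definition half_plane :: "('a \<Rightarrow> real) \<Rightarrow> real \<Rightarrow> 'a set" where
  "half_plane l c = {p. l p \<ge> c}"

text \<open>
  Half-planes with rational slope are represented by pairs \<open>(l, c)\<close> with \<open>l\<close> primitive. The
  half-plane determines this pair, because two primitive functionals that are positive multiples
  of each other are equal; hence the translate \<open>half_plane l (c + t)\<close> depends only on the
  half-plane and \<open>t\<close>.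
\<close>

definition supporting_half_planes ::
    "'a::euclidean_space set \<Rightarrow> 'a set \<Rightarrow> (('a \<Rightarrow> real) \<times> real) set" where
  "supporting_half_planes N \<Phi> =
     {(l, c). primitive N l \<and> \<Phi> \<subseteq> half_plane l c \<and>
              frontier (half_plane l c) \<inter> frontier \<Phi> \<noteq> {}}"

definition admissible :: "'a::euclidean_space set \<Rightarrow> 'a set \<Rightarrow> bool" where
  "admissible N \<Phi> \<longleftrightarrow> closed \<Phi> \<and> convex \<Phi> \<and> supporting_half_planes N \<Phi> \<noteq> {}"

definition evolution :: "'a::euclidean_space set \<Rightarrow> 'a set \<Rightarrow> real \<Rightarrow> 'a set" where
  "evolution N \<Phi> t = (\<Inter>(l, c)\<in>supporting_half_planes N \<Phi>. half_plane l (c + t))"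

definition polygonal_domain :: "'a::euclidean_space set \<Rightarrow> 'a set \<Rightarrow> bool" where
  "polygonal_domain N \<Psi> \<longleftrightarrow> convex \<Psi> \<and>
     (\<forall>R. bounded R \<longrightarrow>
        (\<exists>F. finite F \<and> (\<forall>(l, c)\<in>F. primitive N l) \<and>
             \<Psi> \<inter> R = (\<Inter>(l, c)\<in>F. half_plane l c) \<inter> R))"

end

theory Submission
  imports Defs
begin

text \<open>
  By compactness it suffices that near each point \<open>x\<close> of \<open>\<Phi>(t)\<close> only finitely many of the
  shifted half-planes impose a condition. Otherwise their primitive normals tend to infinity, and
  a limit \<open>w\<close> of the normalised normals is minimised over \<open>\<Phi> \<union> {x}\<close> at \<open>x\<close>. If \<open>g\<close> is one of the
  normals, supporting \<open>\<Phi>\<close> at \<open>q\<close>, then every primitive \<open>\<alpha> g + \<beta> w\<close> with \<open>\<alpha>, \<beta> > 0\<close> attains its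
  minimum on \<open>\<Phi>\<close>, and its value at \<open>x\<close> exceeds this minimum by at most \<open>\<alpha> (g(x) - g(q))\<close>, whereas
  \<open>x \<in> \<Phi>(t)\<close> requires an excess of at least \<open>t\<close>. If \<open>w\<close> has irrational direction, Kronecker's theorem
  provides such functionals with \<open>\<alpha>\<close> arbitrarily small, a contradiction. If \<open>w\<close> is rational, \<open>w\<close> does
  not attain the value \<open>w(x)\<close> on \<open>\<Phi>\<close>, as it would be a supporting functional itself; then functionals
  with fixed \<open>\<alpha>\<close> and \<open>\<beta> \<rightarrow> \<infinity>\<close> give the contradiction.
\<close>

subsection \<open>Coprime integer points in planar cones\<close>

text \<open>Integer points with \<open>p * b - q * a = \<plusminus>1\<close> are coprime, because a
  common divisor divides 1. With \<open>A\<close> the reciprocal of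
  \<open>\<bar>p * v - q * u\<bar>\<close>, the line through \<open>A * (u, v)\<close> in direction
  \<open>(p, q)\<close> contains such a point. Adding multiples of \<open>(p, q)\<close> stays on
  this line and makes \<beta> large.\<close>

lemma coprime_combination_rational:
  fixes p q :: int and u v :: real
  assumes "coprime p q" and "of_int p * v - of_int q * u \<noteq> 0"
  obtains A where "A > 0"
    "\<And>M. \<exists>a b :: int. \<exists>\<beta>\<ge>M. coprime a b \<and>
       of_int a = A * u + \<beta> * of_int p \<and> of_int b = A * v + \<beta> * of_int q"
proof -
  define D where "D = of_int p * v - of_int q * u"
  define \<sigma> :: int where "\<sigma> = (if D > 0 then 1 else -1)"
  define A where "A = 1 / \<bar>D\<bar>"
  have D0: "D \<noteq> 0" using assms(2) by (simp add: D_def)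
  have AD: "A * D = of_int \<sigma>"
    using D0 by (simp add: A_def \<sigma>_def field_simps)
  obtain x y where xy: "x * p + y * q = 1"
    using bezout_int[of p q] assms(1) by auto
  define r where "r = - \<sigma> * y"
  define s where "s = \<sigma> * x"
  have rs: "p * s - q * r = \<sigma>"
  proof -
    have "p * s - q * r = \<sigma> * (x * p + y * q)" by (simp add: r_def s_def algebra_simps)
    then show ?thesis using xy by simp
  qed
  have xy': "of_int x * of_int p + of_int y * of_int q = (1::real)"
    using xy by (metis of_int_1 of_int_add of_int_mult)
  have rs': "of_int p * of_int s - of_int q * of_int r = A * D"
    using rs AD by (metis of_int_diff of_int_mult)
  \<comment> \<open>The Bezout coefficients recover \<beta> from the two required equations
    \<open>r - A * u = \<beta> * p\<close> and \<open>s - A * v = \<beta> * q\<close>.\<close>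
  define \<beta> where "\<beta> = of_int x * (of_int r - A * u) + of_int y * (of_int s - A * v)"
  have r: "of_int r = A * u + \<beta> * of_int p" and s: "of_int s = A * v + \<beta> * of_int q"
    using xy' rs' unfolding \<beta>_def D_def by algebra+
  show ?thesis
  proof
    show "A > 0" using D0 by (simp add: A_def)
    fix M :: real
    define m where "m = \<lceil>M - \<beta>\<rceil>"
    have "p * (s + m * q) - q * (r + m * p) = \<sigma>" using rs by (simp add: algebra_simps)
    moreover have "\<bar>\<sigma>\<bar> = 1" by (simp add: \<sigma>_def)
    ultimately have "coprime (r + m * p) (s + m * q)"
      by (intro coprimeI) (metis dvd_abs_iff dvd_diff dvd_mult)
    moreover have "M \<le> \<beta> + of_int m" unfolding m_def by linarith
    ultimately show "\<exists>a b :: int. \<exists>\<beta>\<ge>M. coprime a b \<and>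
       of_int a = A * u + \<beta> * of_int p \<and> of_int b = A * v + \<beta> * of_int q"
      using r s
      by (intro exI[of _ "r + m * p"] exI[of _ "s + m * q"] exI[of _ "\<beta> + of_int m"])
         (simp add: algebra_simps)
  qed
qed

text \<open>By Cramer's rule, a small positive \<alpha> means that an integer multiple of the
  irrational number \<open>z / w\<close> lies close to an integer, on a prescribed side. Density of
  fractional parts provides this, and dividing by the gcd afterwards does not increase
  \<alpha>.\<close>

lemma coprime_combination_irrational_pos:
  fixes u v w z \<epsilon> :: real
  assumes irr: "z / w \<notin> \<rat>" and D: "w * v - z * u \<noteq> 0" and "\<epsilon> > 0" and w: "w > 0"
  obtains a b :: int and \<alpha> \<beta> where "coprime a b" "0 < \<alpha>" "\<alpha> < \<epsilon>" "0 < \<beta>"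
    "of_int a = \<alpha> * u + \<beta> * w" "of_int b = \<alpha> * v + \<beta> * z"
proof -
  define D where "D = w * v - z * u"
  \<comment> \<open>The second bound keeps \<open>\<alpha> u\<close> below \<open>k \<ge> 1\<close>, so that \<open>\<beta> > 0\<close>.\<close>
  define e where "e = min \<epsilon> (1 / (\<bar>u\<bar> + 1))"
  have e: "e > 0" "e \<le> \<epsilon>" "e * \<bar>u\<bar> < 1"
  proof -
    show "e > 0" "e \<le> \<epsilon>" using \<open>\<epsilon> > 0\<close> by (auto simp: e_def)
    have "e * \<bar>u\<bar> \<le> 1 / (\<bar>u\<bar> + 1) * \<bar>u\<bar>" by (rule mult_right_mono) (auto simp: e_def)
    also have "\<dots> < 1" by (simp add: field_simps)
    finally show "e * \<bar>u\<bar> < 1" .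
  qed
  have D0: "D \<noteq> 0" using D by (simp add: D_def)
  then have "\<bar>D\<bar> * e / (2 * w) > 0" using e w by simp
  \<comment> \<open>The target is the value of \<open>k * (z / w) - h\<close> for
    \<open>\<alpha> = e / 2\<close>. The tolerance is the absolute value of the target, so the
    estimate amounts to \<open>0 < \<alpha> < e\<close>.\<close>
  then obtain h k :: int where "k > 0"
    and hk: "\<bar>of_int k * (z / w) - of_int h - (- (D * e / (2 * w)))\<bar> < \<bar>D\<bar> * e / (2 * w)"
    using sequence_of_fractional_parts_is_dense[OF irr] by blast
  define \<alpha> where "\<alpha> = (w * of_int h - z * of_int k) / D"
  define \<beta> where "\<beta> = (of_int k - \<alpha> * u) / w"
  have "of_int k * (z / w) - of_int h - (- (D * e / (2 * w))) = - (D / w) * (\<alpha> - e / 2)"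
    using w D0 by (simp add: \<alpha>_def field_simps)
  then have "\<bar>D\<bar> / w * \<bar>\<alpha> - e / 2\<bar> < \<bar>D\<bar> / w * (e / 2)"
    using hk w by (simp add: abs_mult)
  then have "\<bar>\<alpha> - e / 2\<bar> < e / 2"
    using D0 w by (simp add: divide_simps)
  then have \<alpha>: "0 < \<alpha>" "\<alpha> < e" by (auto simp: abs_if field_simps split: if_splits)
  have "\<alpha> * u \<le> \<alpha> * \<bar>u\<bar>" using \<alpha> by simp
  also have "\<dots> \<le> e * \<bar>u\<bar>" using \<alpha> by (intro mult_right_mono) auto
  finally have "\<alpha> * u \<le> e * \<bar>u\<bar>" .
  then have "\<alpha> * u < of_int k" using e \<open>k > 0\<close> by linarith
  then have \<beta>: "\<beta> > 0" using w by (simp add: \<beta>_def)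
  have k: "of_int k = \<alpha> * u + \<beta> * w" using w by (simp add: \<beta>_def)
  have h: "of_int h = \<alpha> * v + \<beta> * z"
  proof -
    have 1: "\<alpha> * D = w * of_int h - z * of_int k" using D0 by (simp add: \<alpha>_def)
    have "w * of_int h = w * (\<alpha> * v + \<beta> * z)" using 1 k unfolding D_def by algebra
    then show ?thesis using w by simp
  qed
  define g where "g = gcd k h"
  have g: "g \<ge> 1" using \<open>k > 0\<close> by (simp add: g_def int_one_le_iff_zero_less)
  obtain a b where ab: "k = g * a" "h = g * b" "coprime a b"
    using gcd_coprime_exists[of k h] g unfolding g_def by (metis mult.commute not_one_le_zero)
  have ab': "of_int a = of_int k / (of_int g :: real)" "of_int b = of_int h / (of_int g :: real)"
    using ab g by auto
  show ?thesis
  proof (rule that[of a b "\<alpha> / of_int g" "\<beta> / of_int g"])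
    have "\<alpha> / of_int g \<le> \<alpha>" using g \<alpha> by (simp add: field_simps)
    then show "\<alpha> / of_int g < \<epsilon>" using \<alpha> e by linarith
    show "of_int a = \<alpha> / of_int g * u + \<beta> / of_int g * w"
      unfolding ab' k by (simp add: add_divide_distrib)
    show "of_int b = \<alpha> / of_int g * v + \<beta> / of_int g * z"
      unfolding ab' h by (simp add: add_divide_distrib)
  qed (use ab(3) \<alpha> \<beta> g in auto)
qed

lemma coprime_combination_irrational:
  fixes u v w z \<epsilon> :: real
  assumes irr: "z / w \<notin> \<rat>" and D: "w * v - z * u \<noteq> 0" and \<epsilon>: "\<epsilon> > 0"
  obtains a b :: int and \<alpha> \<beta> where "coprime a b" "0 < \<alpha>" "\<alpha> < \<epsilon>" "0 < \<beta>"
    "of_int a = \<alpha> * u + \<beta> * w" "of_int b = \<alpha> * v + \<beta> * z"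
proof (cases "w > 0")
  case True
  then show ?thesis using coprime_combination_irrational_pos[OF assms] that by metis
next
  case False
  \<comment> \<open>Division by zero yields 0, which is rational.\<close>
  have "w \<noteq> 0" using irr by auto
  with False have "- w > 0" by simp
  moreover have "(- z) / (- w) \<notin> \<rat>" "(- w) * (- v) - (- z) * (- u) \<noteq> 0" using irr D by auto
  ultimately obtain a b :: int and \<alpha> \<beta> where "coprime a b" "0 < \<alpha>" "\<alpha> < \<epsilon>" "0 < \<beta>"
    "of_int a = \<alpha> * (- u) + \<beta> * (- w)" "of_int b = \<alpha> * (- v) + \<beta> * (- z)"
    using coprime_combination_irrational_pos[of "- z" "- w" "- v" "- u" \<epsilon>] \<epsilon> by metis
  then show ?thesis by (intro that[of "- a" "- b" \<alpha> \<beta>]) auto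
qed

subsection \<open>Primitive functionals as vectors\<close>

lemma linear_real_imp_inner:
  fixes f :: "'a::euclidean_space \<Rightarrow> real"
  assumes "linear f"
  obtains g where "f = (\<bullet>) g"
proof
  show "f = (\<bullet>) (adjoint f 1)"
    using adjoint_works[OF assms, of _ 1] by (auto simp: inner_commute)
qed

text \<open>A functional is represented by a vector \<open>g\<close> with coordinates
  \<open>g \<bullet> b1\<close> and \<open>g \<bullet> b2\<close>. The dual basis \<open>d1\<close>,
  \<open>d2\<close> reads off the coordinates of points.\<close>

locale planar_lattice =
  fixes N :: "'a::euclidean_space set" and b1 b2 d1 d2 :: 'a
  assumes dual: "d1 \<bullet> b1 = 1" "d1 \<bullet> b2 = 0" "d2 \<bullet> b1 = 0" "d2 \<bullet> b2 = 1"
    and span: "span {b1, b2} = UNIV"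
    and lattice: "N = {of_int i *\<^sub>R b1 + of_int j *\<^sub>R b2 | i j. True}"

lemma rank_two_lattice_imp_planar_lattice:
  assumes "rank_two_lattice N"
  obtains b1 b2 d1 d2 where "planar_lattice N b1 b2 d1 d2"
proof -
  obtain B where B: "card B = 2" "independent B" "span B = UNIV"
    and N: "N = {\<Sum>b\<in>B. of_int (k b) *\<^sub>R b | k :: 'a \<Rightarrow> int. True}"
    using assms unfolding rank_two_lattice_def by auto
  obtain b1 b2 where b: "B = {b1, b2}" "b1 \<noteq> b2"
    using B(1) by (auto simp: card_2_iff)
  obtain f1 where f1: "linear f1" "\<And>x. x \<in> B \<Longrightarrow> f1 x = (if x = b1 then 1 else 0 :: real)"
    using linear_independent_extend[OF B(2), of "\<lambda>x. if x = b1 then 1 else 0"] by auto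
  obtain f2 where f2: "linear f2" "\<And>x. x \<in> B \<Longrightarrow> f2 x = (if x = b2 then 1 else 0 :: real)"
    using linear_independent_extend[OF B(2), of "\<lambda>x. if x = b2 then 1 else 0"] by auto
  obtain d1 where d1: "f1 = (\<bullet>) d1" using linear_real_imp_inner[OF f1(1)] .
  obtain d2 where d2: "f2 = (\<bullet>) d2" using linear_real_imp_inner[OF f2(1)] .
  have "N = {of_int i *\<^sub>R b1 + of_int j *\<^sub>R b2 | i j. True}"
  proof (intro set_eqI iffI)
    fix x assume "x \<in> {of_int i *\<^sub>R b1 + of_int j *\<^sub>R b2 | i j. True}"
    then obtain i j :: int where "x = of_int i *\<^sub>R b1 + of_int j *\<^sub>R b2" by auto
    then show "x \<in> N" using b unfolding N
      by (auto intro!: exI[of _ "\<lambda>y. if y = b1 then i else j"])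
  qed (use b in \<open>auto simp: N\<close>)
  then have "planar_lattice N b1 b2 d1 d2"
    using f1(2) f2(2) b B(3) d1 d2 by unfold_locales auto
  then show ?thesis by (rule that)
qed

context planar_lattice
begin

text \<open>The determinant of two functionals in lattice coordinates; it is nonzero exactly when
  they are linearly independent.\<close>

definition det2 :: "'a \<Rightarrow> 'a \<Rightarrow> real" where
  "det2 g h = (g \<bullet> b1) * (h \<bullet> b2) - (g \<bullet> b2) * (h \<bullet> b1)"

lemma inner_expansion: "g \<bullet> p = (g \<bullet> b1) * (d1 \<bullet> p) + (g \<bullet> b2) * (d2 \<bullet> p)"
proof -
  have "linear (\<lambda>p. g \<bullet> p)" "linear (\<lambda>p. (g \<bullet> b1) * (d1 \<bullet> p) + (g \<bullet> b2) * (d2 \<bullet> p))"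
    by (auto simp: linear_iff inner_simps algebra_simps)
  then show ?thesis
    by (rule linear_eq_on[where B = "{b1, b2}"]) (auto simp: span dual)
qed

lemma vector_eqI:
  assumes "g \<bullet> b1 = h \<bullet> b1" "g \<bullet> b2 = h \<bullet> b2"
  shows "g = h"
proof -
  have "g \<bullet> p = h \<bullet> p" for p
    unfolding inner_expansion[of g p] inner_expansion[of h p] assms ..
  then show ?thesis using vector_eq_rdot by blast
qed

lemma point_expansion: "p = (d1 \<bullet> p) *\<^sub>R b1 + (d2 \<bullet> p) *\<^sub>R b2"
proof -
  have "g \<bullet> p = g \<bullet> ((d1 \<bullet> p) *\<^sub>R b1 + (d2 \<bullet> p) *\<^sub>R b2)" for g
    using inner_expansion[of g p] by (simp add: inner_simps mult.commute)
  then show ?thesis using vector_eq_ldot by blast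
qed

text \<open>Dividing integer coordinates by their gcd writes \<open>g\<close> as a multiple of a
  dual lattice element; conversely, any integer factor of \<open>g\<close> divides both
  coordinates.\<close>

lemma primitive_inner_iff:
  "primitive N ((\<bullet>) g) \<longleftrightarrow>
     (\<exists>a b :: int. coprime a b \<and> g \<bullet> b1 = of_int a \<and> g \<bullet> b2 = of_int b)"
proof -
  have dual_iff: "(\<bullet>) g \<in> dual_lattice N \<longleftrightarrow> g \<bullet> b1 \<in> \<int> \<and> g \<bullet> b2 \<in> \<int>" for g
  proof
    assume "(\<bullet>) g \<in> dual_lattice N"
    then have I: "g \<bullet> p \<in> \<int>" if "p \<in> N" for p using that by (auto simp: dual_lattice_def)
    have "of_int 1 *\<^sub>R b1 + of_int 0 *\<^sub>R b2 \<in> N" "of_int 0 *\<^sub>R b1 + of_int 1 *\<^sub>R b2 \<in> N"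
      unfolding lattice by blast+
    then show "g \<bullet> b1 \<in> \<int> \<and> g \<bullet> b2 \<in> \<int>" using I by fastforce
  next
    assume "g \<bullet> b1 \<in> \<int> \<and> g \<bullet> b2 \<in> \<int>"
    moreover have "linear ((\<bullet>) g)" by (auto simp: linear_iff inner_simps)
    ultimately show "(\<bullet>) g \<in> dual_lattice N"
      by (auto simp: dual_lattice_def lattice inner_simps)
  qed
  show ?thesis
  proof
    assume P: "primitive N ((\<bullet>) g)"
    then have "g \<bullet> b1 \<in> \<int>" "g \<bullet> b2 \<in> \<int>" using dual_iff by (auto simp: primitive_def)
    then obtain a b :: int where ab: "g \<bullet> b1 = of_int a" "g \<bullet> b2 = of_int b"
      by (auto elim!: Ints_cases)
    \<comment> \<open>If both coordinates vanish, then \<open>k = 0\<close>, and the conclusion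
      \<open>\<bar>k\<bar> = 1\<close> excludes this case too.\<close>
    define k where "k = gcd a b"
    have "k dvd a" "k dvd b" by (simp_all add: k_def)
    then obtain a' b' where ab': "a = k * a'" "b = k * b'" by (elim dvdE)
    define h where "h = of_int a' *\<^sub>R d1 + of_int b' *\<^sub>R d2"
    have "g = of_int k *\<^sub>R h"
      by (rule vector_eqI) (simp_all add: ab ab' h_def dual inner_simps)
    then have "(\<bullet>) g = (\<lambda>p. of_int k * (h \<bullet> p))" by (simp add: fun_eq_iff)
    moreover have "(\<bullet>) h \<in> dual_lattice N" using dual by (simp add: dual_iff h_def inner_simps)
    ultimately have "\<bar>k\<bar> = 1" using P unfolding primitive_def by blast
    then have "coprime a b" by (simp add: k_def coprime_iff_gcd_eq_1)
    then show "\<exists>a b :: int. coprime a b \<and> g \<bullet> b1 = of_int a \<and> g \<bullet> b2 = of_int b"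
      using ab by blast
  next
    assume "\<exists>a b :: int. coprime a b \<and> g \<bullet> b1 = of_int a \<and> g \<bullet> b2 = of_int b"
    then obtain a b :: int where ab: "coprime a b" "g \<bullet> b1 = of_int a" "g \<bullet> b2 = of_int b" by auto
    show "primitive N ((\<bullet>) g)"
      unfolding primitive_def
    proof (intro conjI allI ballI impI)
      show "(\<bullet>) g \<in> dual_lattice N" using ab by (simp add: dual_iff)
      fix k :: int and m assume m: "m \<in> dual_lattice N" and eq: "(\<bullet>) g = (\<lambda>p. of_int k * m p)"
      obtain h where h: "m = (\<bullet>) h"
        using m linear_real_imp_inner unfolding dual_lattice_def by blast
      then obtain i j :: int where "m b1 = of_int i" "m b2 = of_int j"
        using m dual_iff by (auto elim!: Ints_cases)
      then have "of_int a = (of_int (k * i) :: real)" "of_int b = (of_int (k * j) :: real)"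
        using ab eq by (metis of_int_mult)+
      then have "k dvd a" "k dvd b" by (auto simp only: of_int_eq_iff dvd_triv_left)
      then have "is_unit k" using ab(1) by (metis coprime_common_divisor)
      then show "\<bar>k\<bar> = 1" by simp
    qed
  qed
qed

lemma primitive_imp_inner:
  assumes "primitive N l"
  obtains g where "l = (\<bullet>) g" "primitive N ((\<bullet>) g)"
proof -
  have "linear l" using assms by (simp add: primitive_def dual_lattice_def)
  then obtain g where "l = (\<bullet>) g" by (rule linear_real_imp_inner)
  then show ?thesis using assms by (intro that) auto
qed

lemma primitive_nonzero: "primitive N ((\<bullet>) g) \<Longrightarrow> g \<noteq> 0"
  by (auto simp: primitive_inner_iff)

text \<open>Cauchy-Schwarz bounds the integer coordinates. Hence norms are unbounded in any infinite
  family of primitive functionals.\<close>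

lemma finite_primitive_bounded: "finite {g. primitive N ((\<bullet>) g) \<and> norm g \<le> K}"
proof -
  define I where "I = {x :: real. x \<in> \<int> \<and> \<bar>x\<bar> \<le> K * norm b1 \<or> x \<in> \<int> \<and> \<bar>x\<bar> \<le> K * norm b2}"
  have fin: "finite {x :: real. x \<in> \<int> \<and> \<bar>x\<bar> \<le> C}" for C by (rule finite_abs_int_segment)
  have "finite I" unfolding I_def using fin by (simp add: Collect_disj_eq)
  then have "finite (I \<times> I)" by simp
  moreover have "(\<lambda>g. (g \<bullet> b1, g \<bullet> b2)) ` {g. primitive N ((\<bullet>) g) \<and> norm g \<le> K} \<subseteq> I \<times> I"
  proof clarify
    fix g assume g: "primitive N ((\<bullet>) g)" "norm g \<le> K"
    have "\<bar>g \<bullet> b\<bar> \<le> K * norm b" for b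
      using Cauchy_Schwarz_ineq2[of g b] mult_right_mono[OF g(2), of "norm b"] by simp
    then show "g \<bullet> b1 \<in> I \<and> g \<bullet> b2 \<in> I" using g(1) by (auto simp: I_def primitive_inner_iff)
  qed
  ultimately have "finite ((\<lambda>g. (g \<bullet> b1, g \<bullet> b2)) ` {g. primitive N ((\<bullet>) g) \<and> norm g \<le> K})"
    using finite_subset by blast
  then show ?thesis
    by (rule finite_imageD) (auto intro!: inj_onI vector_eqI)
qed

section \<open>Primitive functionals in the open cone spanned by two functionals\<close>

lemma det2_eq_0_imp_scaleR:
  assumes "det2 w g = 0" "w \<noteq> 0"
  obtains \<mu> where "g = \<mu> *\<^sub>R w"
proof (cases "w \<bullet> b1 = 0")
  case True
  then have "w \<bullet> b2 \<noteq> 0" using assms(2) vector_eqI[of w 0] by auto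
  with True assms(1) show ?thesis
    by (intro that[of "(g \<bullet> b2) / (w \<bullet> b2)"] vector_eqI) (auto simp: det2_def)
next
  case False
  with assms(1) show ?thesis
    by (intro that[of "(g \<bullet> b1) / (w \<bullet> b1)"] vector_eqI) (auto simp: det2_def field_simps)
qed

lemma primitive_combination_rational:
  assumes "primitive N ((\<bullet>) w)" "det2 w g \<noteq> 0"
  obtains A where "A > 0" "\<And>M. \<exists>\<beta>\<ge>M. primitive N ((\<bullet>) (A *\<^sub>R g + \<beta> *\<^sub>R w))"
proof -
  obtain p q :: int where pq: "coprime p q" "w \<bullet> b1 = of_int p" "w \<bullet> b2 = of_int q"
    using assms(1) by (auto simp: primitive_inner_iff)
  obtain A where "A > 0"
    and A: "\<And>M. \<exists>a b :: int. \<exists>\<beta>\<ge>M. coprime a b \<and>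
       of_int a = A * (g \<bullet> b1) + \<beta> * of_int p \<and> of_int b = A * (g \<bullet> b2) + \<beta> * of_int q"
    using coprime_combination_rational[OF pq(1), of "g \<bullet> b2" "g \<bullet> b1"] assms(2) pq
    unfolding det2_def by metis
  have "\<exists>\<beta>\<ge>M. primitive N ((\<bullet>) (A *\<^sub>R g + \<beta> *\<^sub>R w))" for M
    using A[of M] pq by (auto simp: primitive_inner_iff inner_simps) metis
  then show ?thesis using that \<open>A > 0\<close> by blast
qed

text \<open>The hypothesis \<open>irr\<close> says that \<open>w\<close> has irrational direction:
  with a rational slope, a positive rescaling of \<open>w\<close> would have coprime
  coordinates.\<close>

lemma primitive_combination_irrational:
  assumes irr: "\<And>s. s > 0 \<Longrightarrow> \<not> primitive N ((\<bullet>) (s *\<^sub>R w))"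
    and "w \<noteq> 0" "det2 w g \<noteq> 0" "\<epsilon> > 0"
  obtains \<alpha> \<beta> where "0 < \<alpha>" "\<alpha> < \<epsilon>" "0 < \<beta>" "primitive N ((\<bullet>) (\<alpha> *\<^sub>R g + \<beta> *\<^sub>R w))"
proof -
  define x y where "x = w \<bullet> b1" and "y = w \<bullet> b2"
  have prim: "primitive N ((\<bullet>) h)"
    if "coprime a b" "h \<bullet> b1 = of_int a" "h \<bullet> b2 = of_int b" for h and a b :: int
    using that by (auto simp: primitive_inner_iff)
  have "y / x \<notin> \<rat>"
  proof
    assume rat: "y / x \<in> \<rat>"
    have "\<exists>s>0. primitive N ((\<bullet>) (s *\<^sub>R w))"
    \<comment> \<open>For \<open>x = 0\<close> the quotient \<open>y / x\<close> is 0 by convention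
      and does not describe the direction. In both cases the scaling factor uses an absolute value
      to stay positive, and the integers carry the signs.\<close>
    proof (cases "x = 0")
      case True
      then have "y \<noteq> 0" using \<open>w \<noteq> 0\<close> vector_eqI[of w 0] by (auto simp: x_def y_def)
      then have "primitive N ((\<bullet>) ((1 / \<bar>y\<bar>) *\<^sub>R w))"
        using True
        by (intro prim[of 0 "if y > 0 then 1 else -1"]) (auto simp: x_def[symmetric] y_def[symmetric])
      then show ?thesis using \<open>y \<noteq> 0\<close> by (intro exI[of _ "1 / \<bar>y\<bar>"]) auto
    next
      case False
      obtain q p :: int where "p > 0" "coprime q p" "y / x = of_int q / of_int p"
        using rat by (metis Rats_cases')
      then have y: "y = x * of_int q / of_int p" using False by (simp add: field_simps)
      have "primitive N ((\<bullet>) ((of_int p / \<bar>x\<bar>) *\<^sub>R w))"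
        using \<open>p > 0\<close> \<open>coprime q p\<close> False
        by (intro prim[of "if x > 0 then p else - p" "if x > 0 then q else - q"])
           (auto simp: x_def[symmetric] y_def[symmetric] y coprime_commute)
      then show ?thesis using False \<open>p > 0\<close> by (intro exI[of _ "of_int p / \<bar>x\<bar>"]) auto
    qed
    then show False using irr by blast
  qed
  then obtain a b :: int and \<alpha> \<beta> where "coprime a b" "0 < \<alpha>" "\<alpha> < \<epsilon>" "0 < \<beta>"
    "of_int a = \<alpha> * (g \<bullet> b1) + \<beta> * x" "of_int b = \<alpha> * (g \<bullet> b2) + \<beta> * y"
    using coprime_combination_irrational[of y x "g \<bullet> b2" "g \<bullet> b1" \<epsilon>] assms
    unfolding det2_def x_def y_def by metis
  then show ?thesis
    by (intro that[of \<alpha> \<beta>] prim[of a b]) (auto simp: inner_simps x_def y_def)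
qed

subsection \<open>Supporting functionals\<close>

text \<open>Independent functionals are coordinates on the plane, so bounding both from both sides
  confines \<open>p\<close> to a parallelogram. The constants \<open>E1\<close> and
  \<open>E2\<close> come from Cramer's rule.\<close>

lemma compact_two_sided_sublevel:
  assumes "closed \<Phi>" and det: "det2 g h \<noteq> 0"
    and lower: "\<And>p. p \<in> \<Phi> \<Longrightarrow> c \<le> g \<bullet> p" "\<And>p. p \<in> \<Phi> \<Longrightarrow> d \<le> h \<bullet> p"
  shows "compact {p \<in> \<Phi>. g \<bullet> p \<le> A \<and> h \<bullet> p \<le> B}" (is "compact ?S")
proof -
  define C where "C = \<bar>c\<bar> + \<bar>A\<bar>"
  define D where "D = \<bar>d\<bar> + \<bar>B\<bar>"
  define E1 where "E1 = (\<bar>h \<bullet> b2\<bar> * C + \<bar>g \<bullet> b2\<bar> * D) / \<bar>det2 g h\<bar>"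
  define E2 where "E2 = (\<bar>g \<bullet> b1\<bar> * D + \<bar>h \<bullet> b1\<bar> * C) / \<bar>det2 g h\<bar>"
  have "norm p \<le> E1 * norm b1 + E2 * norm b2" if p: "p \<in> ?S" for p
  proof -
    have gh: "\<bar>g \<bullet> p\<bar> \<le> C" "\<bar>h \<bullet> p\<bar> \<le> D"
      using p lower[of p] unfolding C_def D_def by auto
    have "det2 g h * (d1 \<bullet> p) = (h \<bullet> b2) * (g \<bullet> p) - (g \<bullet> b2) * (h \<bullet> p)"
      using inner_expansion[of g p] inner_expansion[of h p] unfolding det2_def by algebra
    also have "\<bar>\<dots>\<bar> \<le> \<bar>h \<bullet> b2\<bar> * C + \<bar>g \<bullet> b2\<bar> * D"
      by (rule order_trans[OF abs_triangle_ineq4]) (auto simp: abs_mult gh intro!: add_mono mult_left_mono)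
    finally have 1: "\<bar>d1 \<bullet> p\<bar> \<le> E1" using det by (simp add: E1_def abs_mult field_simps)
    have "det2 g h * (d2 \<bullet> p) = (g \<bullet> b1) * (h \<bullet> p) - (h \<bullet> b1) * (g \<bullet> p)"
      using inner_expansion[of g p] inner_expansion[of h p] unfolding det2_def by algebra
    also have "\<bar>\<dots>\<bar> \<le> \<bar>g \<bullet> b1\<bar> * D + \<bar>h \<bullet> b1\<bar> * C"
      by (rule order_trans[OF abs_triangle_ineq4]) (auto simp: abs_mult gh intro!: add_mono mult_left_mono)
    finally have 2: "\<bar>d2 \<bullet> p\<bar> \<le> E2" using det by (simp add: E2_def abs_mult field_simps)
    have "norm p \<le> \<bar>d1 \<bullet> p\<bar> * norm b1 + \<bar>d2 \<bullet> p\<bar> * norm b2"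
      using norm_triangle_ineq[of "(d1 \<bullet> p) *\<^sub>R b1" "(d2 \<bullet> p) *\<^sub>R b2"]
      by (simp flip: point_expansion)
    also have "\<dots> \<le> E1 * norm b1 + E2 * norm b2"
      using 1 2 by (intro add_mono mult_right_mono) auto
    finally show ?thesis .
  qed
  then have "bounded ?S" by (rule boundedI)
  moreover have "closed ?S"
  proof -
    have "?S = \<Phi> \<inter> ({p. g \<bullet> p \<le> A} \<inter> {p. h \<bullet> p \<le> B})" by auto
    then show ?thesis using assms(1) by (simp add: closed_Int closed_halfspace_le)
  qed
  ultimately show ?thesis by (simp add: compact_eq_bounded_closed)
qed

text \<open>Where the combination is at most its value at some \<open>p0\<close>, the lower bound of
  each functional bounds the other from above. The minimum is thus taken over a compact set.\<close>

lemma positive_combination_attains_min: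
  assumes "closed \<Phi>" "\<Phi> \<noteq> {}" "det2 g h \<noteq> 0"
    and lower: "\<And>p. p \<in> \<Phi> \<Longrightarrow> c \<le> g \<bullet> p" "\<And>p. p \<in> \<Phi> \<Longrightarrow> d \<le> h \<bullet> p"
    and "\<alpha> > 0" "\<beta> > 0"
  obtains q where "q \<in> \<Phi>" "\<And>p. p \<in> \<Phi> \<Longrightarrow> (\<alpha> *\<^sub>R g + \<beta> *\<^sub>R h) \<bullet> q \<le> (\<alpha> *\<^sub>R g + \<beta> *\<^sub>R h) \<bullet> p"
proof -
  define f where "f = (\<lambda>p. (\<alpha> *\<^sub>R g + \<beta> *\<^sub>R h) \<bullet> p)"
  have f: "f p = \<alpha> * (g \<bullet> p) + \<beta> * (h \<bullet> p)" for p by (simp add: f_def inner_simps)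
  obtain p0 where p0: "p0 \<in> \<Phi>" using \<open>\<Phi> \<noteq> {}\<close> by blast
  define S where "S = {p \<in> \<Phi>. g \<bullet> p \<le> (f p0 - \<beta> * d) / \<alpha> \<and> h \<bullet> p \<le> (f p0 - \<alpha> * c) / \<beta>}"
  have inS: "p \<in> S" if "p \<in> \<Phi>" "f p \<le> f p0" for p
  proof -
    have "\<alpha> * c \<le> \<alpha> * (g \<bullet> p)" "\<beta> * d \<le> \<beta> * (h \<bullet> p)"
      using lower that assms by (auto intro: mult_left_mono)
    with that(2) have "\<alpha> * (g \<bullet> p) \<le> f p0 - \<beta> * d" "\<beta> * (h \<bullet> p) \<le> f p0 - \<alpha> * c"
      by (auto simp: f[of p])
    then show ?thesis using that assms by (simp add: S_def pos_le_divide_eq mult.commute)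
  qed
  have "compact S" unfolding S_def by (rule compact_two_sided_sublevel) (use assms in auto)
  moreover have "p0 \<in> S" using p0 inS by simp
  moreover have "continuous_on S f" unfolding f_def by (intro continuous_intros)
  ultimately obtain q where q: "q \<in> S" "\<And>p. p \<in> S \<Longrightarrow> f q \<le> f p"
    using continuous_attains_inf[of S f] by blast
  have "f q \<le> f p" if "p \<in> \<Phi>" for p
  proof (cases "f p \<le> f p0")
    case True
    then show ?thesis using q inS that by blast
  next
    case False
    then show ?thesis using q(2)[OF \<open>p0 \<in> S\<close>] by linarith
  qed
  with q show ?thesis by (intro that[of q]) (auto simp: S_def f_def)
qed

text \<open>Supporting functionals are those attaining their minimum on \<Phi>: closedness puts the
  contact point into \<Phi>, and a minimiser of a nonzero functional is never an interior
  point.\<close>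

lemma supporting_half_planes_iff:
  assumes "closed \<Phi>"
  shows "(l, c) \<in> supporting_half_planes N \<Phi> \<longleftrightarrow>
    (\<exists>g q. l = (\<bullet>) g \<and> primitive N ((\<bullet>) g) \<and> q \<in> \<Phi> \<and> c = g \<bullet> q \<and> (\<forall>p\<in>\<Phi>. g \<bullet> q \<le> g \<bullet> p))"
proof -
  have fr: "frontier (half_plane ((\<bullet>) g) c) = {p. g \<bullet> p = c}" if "primitive N ((\<bullet>) g)" for g c
    using primitive_nonzero[OF that] frontier_halfspace_ge[of g c] by (simp add: half_plane_def)
  show ?thesis
  proof
    assume H: "(l, c) \<in> supporting_half_planes N \<Phi>"
    then obtain g where g: "l = (\<bullet>) g" "primitive N ((\<bullet>) g)"
      by (auto simp: supporting_half_planes_def elim: primitive_imp_inner)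
    then obtain q where "q \<in> frontier \<Phi>" "g \<bullet> q = c"
      using H fr[OF g(2)] by (auto simp: supporting_half_planes_def)
    moreover from this have "q \<in> \<Phi>" using frontier_subset_closed[OF assms] by blast
    ultimately show "\<exists>g q. l = (\<bullet>) g \<and> primitive N ((\<bullet>) g) \<and> q \<in> \<Phi> \<and> c = g \<bullet> q \<and>
        (\<forall>p\<in>\<Phi>. g \<bullet> q \<le> g \<bullet> p)"
      using g H by (auto simp: supporting_half_planes_def half_plane_def)
  next
    assume "\<exists>g q. l = (\<bullet>) g \<and> primitive N ((\<bullet>) g) \<and> q \<in> \<Phi> \<and> c = g \<bullet> q \<and> (\<forall>p\<in>\<Phi>. g \<bullet> q \<le> g \<bullet> p)"
    then obtain g q where g: "l = (\<bullet>) g" "primitive N ((\<bullet>) g)" "c = g \<bullet> q"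
      and q: "q \<in> \<Phi>" "\<forall>p\<in>\<Phi>. g \<bullet> q \<le> g \<bullet> p" by blast
    have sub: "\<Phi> \<subseteq> {p. g \<bullet> q \<le> g \<bullet> p}" using q by auto
    then have "interior \<Phi> \<subseteq> {p. g \<bullet> q < g \<bullet> p}"
      using interior_mono[OF sub] interior_halfspace_ge[of g "g \<bullet> q"] primitive_nonzero[OF g(2)] by auto
    then have "q \<in> frontier \<Phi>" using q(1) closure_subset by (auto simp: frontier_def)
    then show "(l, c) \<in> supporting_half_planes N \<Phi>"
      using g sub fr[OF g(2)] by (auto simp: supporting_half_planes_def half_plane_def)
  qed
qed

lemma mem_evolutionD:
  assumes "closed \<Phi>" "x \<in> evolution N \<Phi> t" "primitive N ((\<bullet>) g)"
    and "q \<in> \<Phi>" "\<And>p. p \<in> \<Phi> \<Longrightarrow> g \<bullet> q \<le> g \<bullet> p"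
  shows "g \<bullet> q + t \<le> g \<bullet> x"
proof -
  have "((\<bullet>) g, g \<bullet> q) \<in> supporting_half_planes N \<Phi>"
    using supporting_half_planes_iff[OF assms(1)] assms(3-5) by blast
  then show ?thesis using assms(2) by (force simp: evolution_def half_plane_def)
qed

subsection \<open>Local finiteness\<close>

text \<open>The combination attains its minimum over \<Phi> at \<open>q\<close>; the inequality is
  the condition its shifted half-plane imposes on \<open>x\<close>, with the contributions of
  \<open>g\<close> and \<open>w\<close> separated.\<close>

lemma evolution_combination_estimate:
  assumes "closed \<Phi>" "\<Phi> \<noteq> {}" "x \<in> evolution N \<Phi> t" "det2 w g \<noteq> 0"
    and "\<And>p. p \<in> \<Phi> \<Longrightarrow> c \<le> g \<bullet> p" "\<And>p. p \<in> \<Phi> \<Longrightarrow> w \<bullet> x \<le> w \<bullet> p"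
    and "\<alpha> > 0" "\<beta> > 0" "primitive N ((\<bullet>) (\<alpha> *\<^sub>R g + \<beta> *\<^sub>R w))"
  obtains q where "q \<in> \<Phi>" "t + \<beta> * (w \<bullet> q - w \<bullet> x) \<le> \<alpha> * (g \<bullet> x - g \<bullet> q)"
proof -
  have "det2 g w \<noteq> 0" using assms(4) by (auto simp: det2_def algebra_simps)
  then obtain q where q: "q \<in> \<Phi>"
    and "\<And>p. p \<in> \<Phi> \<Longrightarrow> (\<alpha> *\<^sub>R g + \<beta> *\<^sub>R w) \<bullet> q \<le> (\<alpha> *\<^sub>R g + \<beta> *\<^sub>R w) \<bullet> p"
    using positive_combination_attains_min[of \<Phi> g w c "w \<bullet> x" \<alpha> \<beta>] assms by metis
  then have "(\<alpha> *\<^sub>R g + \<beta> *\<^sub>R w) \<bullet> q + t \<le> (\<alpha> *\<^sub>R g + \<beta> *\<^sub>R w) \<bullet> x"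
    using mem_evolutionD assms by blast
  then show ?thesis using q by (intro that[of q]) (auto simp: inner_simps algebra_simps)
qed

lemma evolution_no_tangent_rational:
  assumes "closed \<Phi>" "\<Phi> \<noteq> {}" "x \<in> evolution N \<Phi> t" "t > 0"
    and w: "primitive N ((\<bullet>) w)" and lw: "\<And>p. p \<in> \<Phi> \<Longrightarrow> w \<bullet> x \<le> w \<bullet> p"
    and det: "det2 w g \<noteq> 0" and lg: "\<And>p. p \<in> \<Phi> \<Longrightarrow> c \<le> g \<bullet> p"
  shows False
proof -
  have strict: "w \<bullet> x < w \<bullet> q" if q: "q \<in> \<Phi>" for q
  proof (rule ccontr)
    assume "\<not> w \<bullet> x < w \<bullet> q"
    then have eq: "w \<bullet> q = w \<bullet> x" using lw[OF q] by simp
    then have "w \<bullet> q + t \<le> w \<bullet> x" using lw q assms by (intro mem_evolutionD) auto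
    then show False using eq \<open>t > 0\<close> by simp
  qed
  \<comment> \<open>Only this part of \<Phi> matters: the estimate will force
    \<open>g \<bullet> q \<le> g \<bullet> x\<close>, and for such \<open>q\<close> outside
    \<open>S\<close> the gap \<open>w \<bullet> q - w \<bullet> x\<close> exceeds 1, hence
    \<delta>.\<close>
  define S where "S = {p \<in> \<Phi>. w \<bullet> p \<le> w \<bullet> x + 1 \<and> g \<bullet> p \<le> g \<bullet> x}"
  obtain \<delta> where \<delta>: "\<delta> > 0" "\<delta> \<le> 1" "\<And>p. p \<in> S \<Longrightarrow> w \<bullet> x + \<delta> \<le> w \<bullet> p"
  proof (cases "S = {}")
    case True
    then show ?thesis using that[of 1] by simp
  next
    case False
    have "compact S" unfolding S_def by (rule compact_two_sided_sublevel) (use assms in auto)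
    moreover have "continuous_on S (\<lambda>p. w \<bullet> p)" by (intro continuous_intros)
    ultimately obtain q where q: "q \<in> S" "\<And>p. p \<in> S \<Longrightarrow> w \<bullet> q \<le> w \<bullet> p"
      using continuous_attains_inf[of S "\<lambda>p. w \<bullet> p"] False by blast
    have "w \<bullet> x < w \<bullet> q" using strict q by (simp add: S_def)
    moreover have "w \<bullet> q \<le> w \<bullet> x + 1" using q by (simp add: S_def)
    ultimately show ?thesis using q by (intro that[of "w \<bullet> q - w \<bullet> x"]) auto
  qed
  obtain A where A: "A > 0" "\<And>M. \<exists>\<beta>\<ge>M. primitive N ((\<bullet>) (A *\<^sub>R g + \<beta> *\<^sub>R w))"
    using primitive_combination_rational[OF w det] by blast
  \<comment> \<open>The bound 1 keeps \<beta> positive; the other makes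
    \<open>\<beta> * \<delta>\<close> at least \<open>A * (g \<bullet> x - c)\<close>, which bounds
    the right side of the estimate.\<close>
  define M where "M = max 1 (A * (g \<bullet> x - c) / \<delta>)"
  obtain \<beta> where \<beta>: "M \<le> \<beta>" "primitive N ((\<bullet>) (A *\<^sub>R g + \<beta> *\<^sub>R w))" using A(2) by blast
  have "\<beta> > 0" using \<beta>(1) by (simp add: M_def)
  then obtain q where q: "q \<in> \<Phi>" "t + \<beta> * (w \<bullet> q - w \<bullet> x) \<le> A * (g \<bullet> x - g \<bullet> q)"
    using evolution_combination_estimate[OF assms(1-3) det lg lw A(1) _ \<beta>(2)] by blast
  have "0 \<le> \<beta> * (w \<bullet> q - w \<bullet> x)" using \<open>\<beta> > 0\<close> lw[OF q(1)] by simp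
  then have "0 < A * (g \<bullet> x - g \<bullet> q)" using q(2) \<open>t > 0\<close> by linarith
  then have "g \<bullet> q \<le> g \<bullet> x" using A(1) by (simp add: zero_less_mult_iff)
  then have "w \<bullet> x + \<delta> \<le> w \<bullet> q"
    using \<delta> q(1) by (cases "q \<in> S") (auto simp: S_def)
  then have "\<beta> * \<delta> \<le> \<beta> * (w \<bullet> q - w \<bullet> x)" using \<open>\<beta> > 0\<close> by simp
  moreover have "A * (g \<bullet> x - g \<bullet> q) \<le> A * (g \<bullet> x - c)" using A(1) lg[OF q(1)] by simp
  moreover have "A * (g \<bullet> x - c) \<le> \<beta> * \<delta>"
  proof -
    have "A * (g \<bullet> x - c) / \<delta> \<le> \<beta>" using \<beta>(1) by (simp add: M_def)
    then show ?thesis using \<delta>(1) by (simp add: pos_divide_le_eq)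
  qed
  ultimately show False using q(2) \<open>t > 0\<close> by linarith
qed

lemma evolution_no_tangent:
  assumes \<Phi>: "closed \<Phi>" and x: "x \<in> evolution N \<Phi> t" and "t > 0"
    and lw: "\<And>p. p \<in> \<Phi> \<Longrightarrow> w \<bullet> x \<le> w \<bullet> p"
    and g: "primitive N ((\<bullet>) g)" "q \<in> \<Phi>" "\<And>p. p \<in> \<Phi> \<Longrightarrow> g \<bullet> q \<le> g \<bullet> p"
    and gw: "g \<bullet> w > 0"
  shows False
proof -
  have "w \<noteq> 0" "\<Phi> \<noteq> {}" using gw g by auto
  have gx: "g \<bullet> q + t \<le> g \<bullet> x" using mem_evolutionD[OF \<Phi> x] g by blast
  \<comment> \<open>If \<open>g\<close> were parallel to \<open>w\<close>, then
    \<open>g \<bullet> w > 0\<close> would make it a positive multiple, so that \<open>g\<close> too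
    would be at most its minimum over \<Phi> at \<open>x\<close>, against the excess
    \<open>t\<close>.\<close>
  have det: "det2 w g \<noteq> 0"
  proof
    assume "det2 w g = 0"
    then obtain \<mu> where \<mu>: "g = \<mu> *\<^sub>R w" using det2_eq_0_imp_scaleR \<open>w \<noteq> 0\<close> by blast
    moreover have "w \<bullet> w > 0" using \<open>w \<noteq> 0\<close> by simp
    ultimately have "\<mu> > 0" using gw by (auto simp: zero_less_mult_iff simp del: inner_gt_zero_iff)
    then have "g \<bullet> x \<le> g \<bullet> q" using lw[OF g(2)] by (simp add: \<mu>)
    then show False using gx \<open>t > 0\<close> by simp
  qed
  show False
  proof (cases "\<exists>s>0. primitive N ((\<bullet>) (s *\<^sub>R w))")
    case True
    then obtain s where s: "s > 0" "primitive N ((\<bullet>) (s *\<^sub>R w))" by blast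
    have "det2 (s *\<^sub>R w) g = s * det2 w g" by (simp add: det2_def algebra_simps)
    then have "det2 (s *\<^sub>R w) g \<noteq> 0" using det s by simp
    then show False
      using evolution_no_tangent_rational[of \<Phi> x t "s *\<^sub>R w" g "g \<bullet> q"] \<open>\<Phi> \<noteq> {}\<close> assms s by simp
  next
    case False
    \<comment> \<open>For \<open>\<alpha> < \<epsilon>\<close> the excess that \<open>g\<close>
      contributes at \<open>x\<close> stays below \<open>t\<close>.\<close>
    define \<epsilon> where "\<epsilon> = t / (g \<bullet> x - g \<bullet> q)"
    have "\<epsilon> > 0" using gx \<open>t > 0\<close> by (simp add: \<epsilon>_def)
    then obtain \<alpha> \<beta> where ab: "0 < \<alpha>" "\<alpha> < \<epsilon>" "0 < \<beta>" "primitive N ((\<bullet>) (\<alpha> *\<^sub>R g + \<beta> *\<^sub>R w))"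
      using primitive_combination_irrational[of w g \<epsilon>] False \<open>w \<noteq> 0\<close> det by blast
    obtain q' where q': "q' \<in> \<Phi>" "t + \<beta> * (w \<bullet> q' - w \<bullet> x) \<le> \<alpha> * (g \<bullet> x - g \<bullet> q')"
      using evolution_combination_estimate[OF \<Phi> \<open>\<Phi> \<noteq> {}\<close> x det g(3) lw ab(1,3,4)] by blast
    have "0 \<le> \<beta> * (w \<bullet> q' - w \<bullet> x)" using ab lw[OF q'(1)] by simp
    moreover have "\<alpha> * (g \<bullet> x - g \<bullet> q') \<le> \<alpha> * (g \<bullet> x - g \<bullet> q)" using ab g(3)[OF q'(1)] by simp
    moreover have "\<alpha> * (g \<bullet> x - g \<bullet> q) < t"
      using ab gx \<open>t > 0\<close> by (simp add: \<epsilon>_def pos_less_divide_eq)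
    ultimately show False using q'(2) by linarith
  qed
qed

text \<open>Half-planes whose translate contains the ball impose no condition near \<open>x\<close>,
  so the finite set holds all the relevant ones.\<close>

lemma evolution_locally_finite:
  assumes \<Phi>: "closed \<Phi>" and x: "x \<in> evolution N \<Phi> t" and t: "t > 0"
  shows "\<exists>\<epsilon>>0. finite {(l, c) \<in> supporting_half_planes N \<Phi>. \<not> ball x \<epsilon> \<subseteq> half_plane l (c + t)}"
proof (rule ccontr)
  assume neg: "\<not> ?thesis"
  have "\<exists>g q y. primitive N ((\<bullet>) g) \<and> q \<in> \<Phi> \<and> (\<forall>p\<in>\<Phi>. g \<bullet> q \<le> g \<bullet> p) \<and> real (Suc n) < norm g \<and>
      dist x y < 1 / real (Suc n) \<and> g \<bullet> y < g \<bullet> q + t" for n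
  proof -
    define I where "I = {(l, c) \<in> supporting_half_planes N \<Phi>. \<not> ball x (1 / real (Suc n)) \<subseteq> half_plane l (c + t)}"
    have "1 / real (Suc n) > 0" by simp
    then have inf: "infinite I" using neg unfolding I_def by blast
    have rep: "\<exists>g q. l = (\<bullet>) g \<and> primitive N ((\<bullet>) g) \<and> q \<in> \<Phi> \<and> c = g \<bullet> q \<and> (\<forall>p\<in>\<Phi>. g \<bullet> q \<le> g \<bullet> p)"
      if "(l, c) \<in> I" for l c
      using that unfolding I_def supporting_half_planes_iff[OF \<Phi>, symmetric] by simp
    \<comment> \<open>The offset is the minimum of the functional over \<Phi>, so infinitely many
      pairs involve infinitely many functionals, and some have large norm.\<close>
    have "inj_on fst I"
    proof (rule inj_onI)
      fix u v assume uv: "u \<in> I" "v \<in> I" "fst u = fst v"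
      obtain l c d where eq: "u = (l, c)" "v = (l, d)" using uv(3) by (cases u; cases v) auto
      obtain g q where 1: "l = (\<bullet>) g" "q \<in> \<Phi>" "c = g \<bullet> q" "\<forall>p\<in>\<Phi>. g \<bullet> q \<le> g \<bullet> p"
        using rep uv eq by blast
      obtain g' q' where 2: "l = (\<bullet>) g'" "q' \<in> \<Phi>" "d = g' \<bullet> q'" "\<forall>p\<in>\<Phi>. g' \<bullet> q' \<le> g' \<bullet> p"
        using rep uv eq by blast
      have "g \<bullet> p = g' \<bullet> p" for p using 1(1) 2(1) by metis
      then show "u = v" using 1 2 eq by (metis order_antisym)
    qed
    then have "infinite (fst ` I)" using inf finite_imageD by blast
    then obtain l where l: "l \<in> fst ` I"
      "l \<notin> (\<bullet>) ` {g. primitive N ((\<bullet>) g) \<and> norm g \<le> real (Suc n)}"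
      using finite_primitive_bounded finite_imageI by (meson finite_subset subsetI)
    then obtain c where c: "(l, c) \<in> I" by auto
    then obtain g q where g: "l = (\<bullet>) g" "primitive N ((\<bullet>) g)" "q \<in> \<Phi>" "c = g \<bullet> q"
      "\<forall>p\<in>\<Phi>. g \<bullet> q \<le> g \<bullet> p" using rep by blast
    have "\<not> ball x (1 / real (Suc n)) \<subseteq> half_plane l (c + t)" using c by (simp add: I_def)
    then obtain y where "y \<in> ball x (1 / real (Suc n))" "y \<notin> half_plane l (c + t)" by blast
    moreover have "real (Suc n) < norm g" using l(2) g by force
    ultimately show ?thesis using g by (auto simp: half_plane_def not_le)
  qed
  then obtain g q y where g: "\<And>n. primitive N ((\<bullet>) (g n))" "\<And>n. q n \<in> \<Phi>"
      "\<And>n p. p \<in> \<Phi> \<Longrightarrow> g n \<bullet> q n \<le> g n \<bullet> p" "\<And>n. real (Suc n) < norm (g n)"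
    and y: "\<And>n. dist x (y n) < 1 / real (Suc n)" "\<And>n. g n \<bullet> y n < g n \<bullet> q n + t"
    by metis
  define u where "u n = g n /\<^sub>R norm (g n)" for n
  have gpos: "norm (g n) > 0" for n using g(4)[of n] by linarith
  have "u n \<in> sphere 0 1" for n using gpos[of n] by (simp add: u_def)
  then obtain w r where w: "w \<in> sphere 0 1" and r: "strict_mono (r :: nat \<Rightarrow> nat)"
    and lim: "(u \<circ> r) \<longlonglongrightarrow> w"
    using compact_sphere[of 0 1] unfolding compact_def by blast
  have lim0: "(\<lambda>n. 1 / real (Suc n)) \<longlonglongrightarrow> 0" by (rule LIMSEQ_Suc[OF lim_1_over_n])
  have "y \<longlonglongrightarrow> x"
  proof (rule metric_LIMSEQ_I)
    fix e :: real assume "e > 0"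
    then obtain n0 where n0: "1 / real (Suc n0) < e" using nat_approx_posE by blast
    have "dist (y n) x < e" if "n \<ge> n0" for n
    proof -
      have "1 / real (Suc n) \<le> 1 / real (Suc n0)" using that by (simp add: frac_le)
      then show ?thesis using y(1)[of n] n0 by (simp add: dist_commute)
    qed
    then show "\<exists>n0. \<forall>n\<ge>n0. dist (y n) x < e" by blast
  qed
  then have limy: "(y \<circ> r) \<longlonglongrightarrow> x" using r by (rule LIMSEQ_subseq_LIMSEQ)
  have lim0r: "(\<lambda>n. t * (1 / real (Suc (r n)))) \<longlonglongrightarrow> 0"
    using tendsto_mult_right_zero[OF LIMSEQ_subseq_LIMSEQ[OF lim0 r], of t] by (simp add: o_def)
  \<comment> \<open>Each \<open>g n\<close> satisfies
    \<open>g n \<bullet> y n - t < g n \<bullet> p\<close>. After division by the norm, which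
    exceeds \<open>n + 1\<close>, the shift \<open>t\<close> disappears in the limit.\<close>
  have lw: "w \<bullet> x \<le> w \<bullet> p" if p: "p \<in> \<Phi>" for p
  proof (rule LIMSEQ_le)
    show "(\<lambda>n. (u \<circ> r) n \<bullet> (y \<circ> r) n - t * (1 / real (Suc (r n)))) \<longlonglongrightarrow> w \<bullet> x"
      using tendsto_diff[OF tendsto_inner[OF lim limy] lim0r] by simp
    show "(\<lambda>n. (u \<circ> r) n \<bullet> p) \<longlonglongrightarrow> w \<bullet> p" by (intro tendsto_inner lim tendsto_const)
    have "u n \<bullet> y n - t * (1 / real (Suc n)) \<le> u n \<bullet> p" for n
    proof -
      have "g n \<bullet> y n - t \<le> g n \<bullet> p" using y(2)[of n] g(3)[OF p, of n] by linarith
      then have "(g n \<bullet> y n - t) / norm (g n) \<le> (g n \<bullet> p) / norm (g n)"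
        using gpos[of n] by (simp add: divide_right_mono)
      then have "u n \<bullet> y n - t / norm (g n) \<le> u n \<bullet> p"
        by (simp add: u_def diff_divide_distrib divide_inverse_commute right_diff_distrib)
      moreover have "t / norm (g n) \<le> t * (1 / real (Suc n))"
        using g(4)[of n] t by (simp add: frac_le)
      ultimately show ?thesis by linarith
    qed
    then show "\<exists>n0. \<forall>n\<ge>n0. (u \<circ> r) n \<bullet> (y \<circ> r) n - t * (1 / real (Suc (r n))) \<le> (u \<circ> r) n \<bullet> p"
      by simp
  qed
  \<comment> \<open>Normals far along the subsequence make an acute angle with their limit
    direction; one of them serves as \<open>g\<close> in the contradiction.\<close>
  have "(\<lambda>n. (u \<circ> r) n \<bullet> w) \<longlonglongrightarrow> w \<bullet> w" by (intro tendsto_inner lim tendsto_const)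
  moreover have "w \<bullet> w > 0" using w by auto
  ultimately have "eventually (\<lambda>n. (u \<circ> r) n \<bullet> w > 0) sequentially" by (rule order_tendstoD)
  then obtain n where "u n \<bullet> w > 0" by (auto simp: eventually_sequentially)
  then have "g n \<bullet> w > 0" using gpos[of n] by (simp add: u_def zero_less_mult_iff)
  then show False using evolution_no_tangent[OF \<Phi> x t lw g(1,2,3)] by blast
qed

section \<open>From local finiteness to polygonal domains by compactness\<close>

lemma polygonal_domain_evolution:
  assumes \<Phi>: "closed \<Phi>" and t: "t > 0"
  shows "polygonal_domain N (evolution N \<Phi> t)"
proof -
  define H where "H = supporting_half_planes N \<Phi>"
  define J where "J F = (\<Inter>(l, c)\<in>F. half_plane l (c + t))" for F :: "(('a \<Rightarrow> real) \<times> real) set"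
  have ev: "evolution N \<Phi> t = J H" by (simp add: evolution_def J_def H_def)
  have inner: "\<exists>g. l = (\<bullet>) g" if "(l, c) \<in> H" for l c
    using that supporting_half_planes_iff[OF \<Phi>] unfolding H_def by blast
  have "convex (J H)"
    unfolding J_def
  proof (rule convex_INT, clarify)
    fix l c assume "(l, c) \<in> H"
    then obtain g where "l = (\<bullet>) g" using inner by blast
    then show "convex (half_plane l (c + t))" by (simp add: half_plane_def convex_halfspace_ge)
  qed
  moreover have "\<exists>F. finite F \<and> (\<forall>(l, c)\<in>F. primitive N l) \<and>
      J H \<inter> R = (\<Inter>(l, c)\<in>F. half_plane l c) \<inter> R" if R: "bounded R" for R
  proof -
    \<comment> \<open>Points outside the evolved set need neighbourhoods as well, since the cover
      must contain all of \<open>closure R\<close>.\<close>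
    have "\<exists>U F. open U \<and> y \<in> U \<and> finite F \<and> F \<subseteq> H \<and> J F \<inter> U \<subseteq> J H" for y
    proof (cases "y \<in> J H")
      case True
      then have "y \<in> evolution N \<Phi> t" by (simp add: ev)
      from evolution_locally_finite[OF \<Phi> this t] obtain e where e: "e > 0"
        "finite {(l, c) \<in> H. \<not> ball y e \<subseteq> half_plane l (c + t)}" (is "finite ?F")
        unfolding H_def by blast
      have "J ?F \<inter> ball y e \<subseteq> J H" unfolding J_def by blast
      then show ?thesis using e by (intro exI[of _ "ball y e"] exI[of _ ?F]) auto
    next
      case False
      then obtain l c where lc: "(l, c) \<in> H" "y \<notin> half_plane l (c + t)" by (auto simp: J_def)
      obtain g where "l = (\<bullet>) g" using inner lc by blast
      then have "closed (half_plane l (c + t))" by (simp add: half_plane_def closed_halfspace_ge)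
      \<comment> \<open>The neighbourhood is the complement of a violated half-plane, so the
        intersection is empty and the inclusion trivial.\<close>
      then show ?thesis using lc
        by (intro exI[of _ "- half_plane l (c + t)"] exI[of _ "{(l, c)}"]) (auto simp: J_def)
    qed
    then obtain U F where UF: "\<And>y. open (U y)" "\<And>y. y \<in> U y" "\<And>y. finite (F y)" "\<And>y. F y \<subseteq> H"
      "\<And>y. J (F y) \<inter> U y \<subseteq> J H" by metis
    have "compact (closure R)" using R by simp
    moreover have "closure R \<subseteq> (\<Union>y\<in>closure R. U y)" using UF(2) by blast
    ultimately obtain Y where Y: "finite Y" "closure R \<subseteq> (\<Union>y\<in>Y. U y)"
      using compactE_image[of "closure R" "closure R" U] UF(1) by metis
    define G where "G = (\<Union>y\<in>Y. F y)"
    have "J H \<inter> R = J G \<inter> R"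
    proof
      have "G \<subseteq> H" using UF(4) by (auto simp: G_def)
      then show "J H \<inter> R \<subseteq> J G \<inter> R" unfolding J_def by blast
      show "J G \<inter> R \<subseteq> J H \<inter> R"
      proof
        fix z assume z: "z \<in> J G \<inter> R"
        then have "z \<in> closure R" using closure_subset by blast
        then obtain y where "y \<in> Y" "z \<in> U y" using Y(2) by blast
        moreover from this have "z \<in> J (F y)" using z unfolding J_def G_def by blast
        ultimately show "z \<in> J H \<inter> R" using UF(5) z by blast
      qed
    qed
    \<comment> \<open>The shift by \<open>t\<close> is absorbed into the offsets, as a polygonal
      domain refers to unshifted half-planes.\<close>
    moreover have "J G = (\<Inter>(l, c)\<in>(\<lambda>(l, c). (l, c + t)) ` G. half_plane l c)"
      by (auto simp: J_def)
    moreover have "finite G" using Y(1) UF(3) by (simp add: G_def)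
    moreover have "\<forall>(l, c)\<in>(\<lambda>(l, c). (l, c + t)) ` G. primitive N l"
      using UF(4) unfolding G_def H_def supporting_half_planes_def by fast
    ultimately show ?thesis by (intro exI[of _ "(\<lambda>(l, c). (l, c + t)) ` G"]) auto
  qed
  ultimately show ?thesis unfolding polygonal_domain_def ev by blast
qed

end

theorem proposition24:
  fixes N \<Phi> :: "'a::euclidean_space set" and t :: real
  assumes "rank_two_lattice N"
    and "admissible N \<Phi>"
    and "t > 0"
  shows "polygonal_domain N (evolution N \<Phi> t)"
proof -
  obtain b1 b2 d1 d2 where "planar_lattice N b1 b2 d1 d2"
    using rank_two_lattice_imp_planar_lattice[OF assms(1)] .
  then interpret planar_lattice N b1 b2 d1 d2 .
  show ?thesis using polygonal_domain_evolution assms(2,3) by (simp add: admissible_def)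
qed

end
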